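(* Let $d\ge 2$, $p\ge 1$, let $C^k_{\alpha_1,\dots,\alpha_d}\in\mathbb{R}$ be given for $0\le k\le p$ and $\alpha\in(\mathbb{Z}^+)^d$ with $|\alpha|=k$, and consider the linear partial differential equation with constant coefficients $$E(u):=\sum_{k=0}^p\ \sum_{|\alpha|=k} C^k_{\alpha_1,\dots,\alpha_d}\,\frac{\partial^k u}{\partial x_1^{\alpha_1}\cdots\partial x_d^{\alpha_d}}=0 .$$ Let $\{\mathbb{E}^n\}_{n=2}^\infty$ be a sequence of extensions with structure constants $\Upsilon^s_{r,k}$, and let $e_1,\dots,e_d$, $e_j=\sum_{r\ge0}a_{jr}I_r$ with $a_{jr}\in\mathbb{C}$, be vectors on this sequence which satisfy on it the characteristic equation $$\sum_{k=0}^p\ \sum_{|\alpha|=k} C^k_{\alpha_1,\dots,\alpha_d}\,e_1^{\alpha_1}\cdots e_d^{\alpha_d}=0 .$$ Let $\xi=\sum_j x_ja_{j0}$, $\xi_s=\sum_j x_ja_{js}$ ($s\ge1$), and let $A_k=A_k(x_1,\dots,x_d,t)$ be defined for $t\ne\xi$ by $$A_0=\frac1{t-\xi},\quad A_1=\frac{\xi_1}{(t-\xi)^2},\quad A_s=\frac{\xi_s}{(t-\xi)^2}+\frac1{t-\xi}\sum_{r=1}^{s-1}A_r B_{r,s},\quad B_{r,s}=\sum_{k=1}^{s-1}\xi_k\Upsilon^k_{r,s},\quad s\ge2 .$$ Then for every $k=0,1,2,\dots$ the function $$u_k(x_1,\dots,x_d)=\frac1{2\pi i}\int_\Gamma e^t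 A_k(x_1,\dots,x_d,t)\,dt,\qquad (x_1,\dots,x_d)\in\mathbb{R}^d,$$ satisfies $E(u_k)=0$, where $\Gamma$ is a closed Jordan rectifiable curve (positively oriented) in the complex plane surrounding the point $\xi=\xi(x_1,\dots,x_d)$.
   Context: $\mathbb{Z}^+=\{0,1,2,\dots\}$ and $|\alpha|=\alpha_1+\dots+\alpha_d$. Sequence of extensions. For each $n\ge2$, $\mathbb{E}^n$ is an $n$-dimensional commutative associative unital algebra over $\mathbb{C}$ whose only nonzero idempotent is the unit, with basis $I_0=1,I_1,\dots,I_{n-1}$ and multiplication $$I_rI_s=\sum_{k=\max\{r,s\}+1}^{n-1}\Upsilon^s_{r,k}I_k\qquad (1\le r,s\le n-1),$$ and the structure constants of $\mathbb{E}^{n+1}$ coincide with those of $\mathbb{E}^n$ for all indices $k\in\{2,\dots,n-1\}$, $r,s\in\{1,\dots,k-1\}$ (i.e. deleting the last basis element of $\mathbb{E}^{n+1}$ from its multiplication table gives the table of $\mathbb{E}^n$; $\mathbb{E}^{n+1}$ is called an extension of $\mathbb{E}^n$). Hence the constants $\Upsilon^s_{r,k}$ do not depend on $n$. They are taken to be $0$ when $k\le\max\{r,s\}$. A vector $e=\sum_{r\ge0}c_rI_r$ ($c_r\in\mathbb{C}$) on the sequence means the family of truncations $e(n)=\sum_{r=0}^{n-1}c_rI_r\in\mathbb{E}^n$, $n=2,3,\dots$. Vectors $e_1,\dots,e_d$ satisfy an algebraic equation on the sequence if for every $n=2,3,\dots$ the truncations $e_1(n),\dots,e_d(n)$ satisfy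 it in $\mathbb{E}^n$. *)

theory Defs
  imports
    "HOL-Complex_Analysis.Complex_Analysis"
    "HOL-Algebra.Module"
    "HOL-Algebra.Algebraic_Closure_Type"
begin

section \<open>Sequences of extensions\<close>

abbreviation complex_field :: "complex ring" where
  "complex_field \<equiv> ring_of_type_algebra"

text \<open>Used with \<open>M = \<bbbE>\<^sup>n\<close> and \<open>b = (I\<^sub>0, \<dots>, I\<^sub>n\<^sub>-\<^sub>1)\<close>, the vector
  \<open>c\<^sub>0 I\<^sub>0 + \<dots> + c\<^sub>n\<^sub>-\<^sub>1 I\<^sub>n\<^sub>-\<^sub>1\<close> is the truncation \<open>e(n)\<close> of the formal vector \<open>e = (c\<^sub>r)\<close>.\<close>

definition truncation ::
    "(complex, 'a) module \<Rightarrow> (nat \<Rightarrow> 'a) \<Rightarrow> nat \<Rightarrow> (nat \<Rightarrow> complex) \<Rightarrow> 'a" where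
  "truncation M b n c = (\<Oplus>\<^bsub>M\<^esub> r\<in>{..<n}. c r \<odot>\<^bsub>M\<^esub> b r)"

definition is_basis :: "(complex, 'a) module \<Rightarrow> (nat \<Rightarrow> 'a) \<Rightarrow> nat \<Rightarrow> bool" where
  "is_basis M b n \<longleftrightarrow>
     (\<forall>r<n. b r \<in> carrier M) \<and>
     (\<forall>v\<in>carrier M. \<exists>c. v = truncation M b n c) \<and>
     (\<forall>c. truncation M b n c = \<zero>\<^bsub>M\<^esub> \<longrightarrow> (\<forall>r<n. c r = 0))"

text \<open>\<open>\<Upsilon> r s k\<close> is the structure constant \<open>\<Upsilon>\<^sup>s\<^sub>r\<^sub>,\<^sub>k\<close>.  That each algebra of the sequence
  extends the previous one is expressed by \<open>\<Upsilon>\<close> being the same for all \<open>n\<close>.  The HOL-Algebra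
  locale \<^locale>\<open>algebra\<close> comprises commutativity, associativity and the existence of a unit.\<close>

definition extension_sequence ::
    "(nat \<Rightarrow> (complex, 'a) module) \<Rightarrow> (nat \<Rightarrow> nat \<Rightarrow> 'a) \<Rightarrow>
     (nat \<Rightarrow> nat \<Rightarrow> nat \<Rightarrow> complex) \<Rightarrow> bool" where
  "extension_sequence \<E> I \<Upsilon> \<longleftrightarrow>
     (\<forall>r\<ge>1. \<forall>s\<ge>1. \<forall>k\<le>max r s. \<Upsilon> r s k = 0) \<and>
     (\<forall>n\<ge>2.
        algebra complex_field (\<E> n) \<and>
        (\<forall>v\<in>carrier (\<E> n). v \<otimes>\<^bsub>\<E> n\<^esub> v = v \<longrightarrow> v = \<zero>\<^bsub>\<E> n\<^esub> \<or> v = \<one>\<^bsub>\<E> n\<^esub>) \<and>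
        is_basis (\<E> n) (I n) n \<and>
        I n 0 = \<one>\<^bsub>\<E> n\<^esub> \<and>
        (\<forall>r\<in>{1..n-1}. \<forall>s\<in>{1..n-1}.
           I n r \<otimes>\<^bsub>\<E> n\<^esub> I n s =
             (\<Oplus>\<^bsub>\<E> n\<^esub> k\<in>{max r s + 1..n-1}. \<Upsilon> r s k \<odot>\<^bsub>\<E> n\<^esub> I n k)))"


section \<open>The differential equation and its characteristic equation\<close>

definition multi_indices :: "nat \<Rightarrow> ('d::finite \<Rightarrow> nat) set" where
  "multi_indices k = {\<alpha>. (\<Sum>j\<in>UNIV. \<alpha> j) = k}"

definition characteristic_value ::
    "(complex, 'a) module \<Rightarrow> nat \<Rightarrow> (nat \<Rightarrow> ('d::finite \<Rightarrow> nat) \<Rightarrow> real) \<Rightarrow> ('d \<Rightarrow> 'a) \<Rightarrow> 'a" where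
  "characteristic_value M p C e =
     (\<Oplus>\<^bsub>M\<^esub> k\<in>{..p}. \<Oplus>\<^bsub>M\<^esub> \<alpha>\<in>multi_indices k.
        complex_of_real (C k \<alpha>) \<odot>\<^bsub>M\<^esub> (\<Otimes>\<^bsub>M\<^esub> j\<in>UNIV. e j [^]\<^bsub>M\<^esub> \<alpha> j))"

definition partial_deriv ::
    "'d::finite \<Rightarrow> (real^'d \<Rightarrow> complex) \<Rightarrow> real^'d \<Rightarrow> complex" where
  "partial_deriv j u x = vector_derivative (\<lambda>h. u (x + h *\<^sub>R axis j 1)) (at 0)"

text \<open>\<open>u\<close> is of class \<open>C\<^sup>p\<close> on the whole space.\<close>

primrec C_class :: "nat \<Rightarrow> (real^'d::finite \<Rightarrow> complex) \<Rightarrow> bool" where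
  "C_class 0 u \<longleftrightarrow> continuous_on UNIV u"
| "C_class (Suc p) u \<longleftrightarrow> continuous_on UNIV u \<and>
     (\<forall>j. (\<forall>x. (\<lambda>h::real. u (x + h *\<^sub>R axis j 1)) differentiable (at 0)) \<and>
          C_class p (partial_deriv j u))"

text \<open>\<open>\<partial>\<^sup>|\<^sup>\<alpha>\<^sup>| u / \<partial>x\<^sub>1\<^sup>\<alpha>\<^sup>1 \<dots> \<partial>x\<^sub>d\<^sup>\<alpha>\<^sup>d\<close>, where the linear order on the index type plays the role of
  the order of \<open>1, \<dots>, d\<close>; the derivative with respect to the last variable is taken first.\<close>

definition mixed_partial ::
    "('d::{finite,linorder} \<Rightarrow> nat) \<Rightarrow> ((real, 'd) vec \<Rightarrow> complex) \<Rightarrow> (real, 'd) vec \<Rightarrow> complex" where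
  "mixed_partial \<alpha> u =
     foldr (\<lambda>j. partial_deriv j ^^ \<alpha> j) (sorted_list_of_set UNIV) u"

definition diff_operator ::
    "nat \<Rightarrow> (nat \<Rightarrow> ('d::{finite,linorder} \<Rightarrow> nat) \<Rightarrow> real) \<Rightarrow>
     ((real, 'd) vec \<Rightarrow> complex) \<Rightarrow> (real, 'd) vec \<Rightarrow> complex" where
  "diff_operator p C u x =
     (\<Sum>k\<le>p. \<Sum>\<alpha>\<in>multi_indices k. complex_of_real (C k \<alpha>) * mixed_partial \<alpha> u x)"

text \<open>Since derivatives are total functions in HOL, a (classical) solution is explicitly required
  to be of class \<open>C\<^sup>p\<close>.\<close>

definition solves_pde ::
    "nat \<Rightarrow> (nat \<Rightarrow> ('d::{finite,linorder} \<Rightarrow> nat) \<Rightarrow> real) \<Rightarrow> ((real, 'd) vec \<Rightarrow> complex) \<Rightarrow> bool" where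
  "solves_pde p C u \<longleftrightarrow> C_class p u \<and> (\<forall>x. diff_operator p C u x = 0)"


section \<open>The functions \<open>A\<^sub>k\<close>\<close>

text \<open>\<open>xi a x s\<close> is \<open>\<xi>\<^sub>s\<close>; in particular \<open>xi a x 0\<close> is \<open>\<xi>\<close>.\<close>

definition xi :: "('d::finite \<Rightarrow> nat \<Rightarrow> complex) \<Rightarrow> real^'d \<Rightarrow> nat \<Rightarrow> complex" where
  "xi a x s = (\<Sum>j\<in>UNIV. complex_of_real (vec_nth x j) * a j s)"

definition B_coeff ::
    "(nat \<Rightarrow> nat \<Rightarrow> nat \<Rightarrow> complex) \<Rightarrow> (nat \<Rightarrow> complex) \<Rightarrow> nat \<Rightarrow> nat \<Rightarrow> complex" where
  "B_coeff \<Upsilon> \<xi> r s = (\<Sum>k=1..s-1. \<xi> k * \<Upsilon> r k s)"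

fun A_coeff ::
    "(nat \<Rightarrow> nat \<Rightarrow> nat \<Rightarrow> complex) \<Rightarrow> (nat \<Rightarrow> complex) \<Rightarrow> complex \<Rightarrow> nat \<Rightarrow> complex" where
  "A_coeff \<Upsilon> \<xi> t 0 = 1 / (t - \<xi> 0)"
| "A_coeff \<Upsilon> \<xi> t (Suc 0) = \<xi> 1 / (t - \<xi> 0)^2"
| "A_coeff \<Upsilon> \<xi> t (Suc (Suc m)) =
     \<xi> (Suc (Suc m)) / (t - \<xi> 0)^2 +
     1 / (t - \<xi> 0) * (\<Sum>r=1..Suc m. A_coeff \<Upsilon> \<xi> t r * B_coeff \<Upsilon> \<xi> r (Suc (Suc m)))"


section \<open>Integration along rectifiable curves\<close>

definition partition01 :: "nat \<Rightarrow> (nat \<Rightarrow> real) \<Rightarrow> bool" where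
  "partition01 n s \<longleftrightarrow> s 0 = 0 \<and> s n = 1 \<and> (\<forall>i<n. s i \<le> s (Suc i))"

definition rectifiable_path :: "(real \<Rightarrow> complex) \<Rightarrow> bool" where
  "rectifiable_path \<gamma> \<longleftrightarrow> path \<gamma> \<and>
     (\<exists>L. \<forall>n s. partition01 n s \<longrightarrow> (\<Sum>i<n. dist (\<gamma> (s i)) (\<gamma> (s (Suc i)))) \<le> L)"

text \<open>The integral along a rectifiable curve, as a limit of Riemann-Stieltjes sums.  The library's
  \<^const>\<open>contour_integral\<close> is defined through the pointwise derivative of the parametrization, which
  is not adequate for an arbitrary continuous parametrization of bounded variation.\<close>

definition has_line_integral ::
    "(complex \<Rightarrow> complex) \<Rightarrow> complex \<Rightarrow> (real \<Rightarrow> complex) \<Rightarrow> bool" where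
  "has_line_integral f J \<gamma> \<longleftrightarrow>
     (\<forall>\<epsilon>>0. \<exists>\<delta>>0. \<forall>n s \<tau>.
        partition01 n s \<and> (\<forall>i<n. s (Suc i) - s i < \<delta> \<and> s i \<le> \<tau> i \<and> \<tau> i \<le> s (Suc i)) \<longrightarrow>
        norm ((\<Sum>i<n. f (\<gamma> (\<tau> i)) * (\<gamma> (s (Suc i)) - \<gamma> (s i))) - J) < \<epsilon>)"

definition line_integral :: "(complex \<Rightarrow> complex) \<Rightarrow> (real \<Rightarrow> complex) \<Rightarrow> complex" where
  "line_integral f \<gamma> = (THE J. has_line_integral f J \<gamma>)"

definition pos_oriented_jordan_curve :: "(real \<Rightarrow> complex) \<Rightarrow> bool" where
  "pos_oriented_jordan_curve \<gamma> \<longleftrightarrow>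
     simple_path \<gamma> \<and> pathfinish \<gamma> = pathstart \<gamma> \<and>
     (\<forall>z\<in>inside (path_image \<gamma>). winding_number \<gamma> z = 1)"

definition u_fun ::
    "(nat \<Rightarrow> nat \<Rightarrow> nat \<Rightarrow> complex) \<Rightarrow> ('d::finite \<Rightarrow> nat \<Rightarrow> complex) \<Rightarrow>
     (real^'d \<Rightarrow> real \<Rightarrow> complex) \<Rightarrow> nat \<Rightarrow> real^'d \<Rightarrow> complex" where
  "u_fun \<Upsilon> a \<Gamma> k x =
     1 / (2 * of_real pi * \<i>) * line_integral (\<lambda>t. exp t * A_coeff \<Upsilon> (xi a x) t k) (\<Gamma> x)"

end

theory Submission
  imports Defs
begin

text \<open>
  The functions \<open>u\<^sub>k\<close> are the components of one exponential.  The product \<open>\<star>\<close> defined by the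
  structure constants makes the formal vectors \<open>e = \<Sum>\<^sub>r c\<^sub>r I\<^sub>r\<close> a commutative associative unital
  algebra, and a family of identities between truncations is the same as an identity there
  (\<open>truncation_vmult\<close>, \<open>truncations_eqI\<close>).  Put \<open>\<zeta> = \<Sum>\<^sub>j x\<^sub>j e\<^sub>j = \<xi> + N\<close>, where \<open>N\<close> has no component along
  the unit.  As the multiplication table is strictly triangular, \<open>N\<close> is nilpotent in every
  component, and the recursion for the \<open>A\<^sub>k\<close> is that of the components of
  \<open>(t - \<zeta>)\<^sup>-\<^sup>1 = \<Sum>\<^sub>m N\<^sup>m / (t - \<xi>)\<^sup>m\<^sup>+\<^sup>1\<close> (\<open>A_coeff_eq\<close>).

  Therefore \<open>u\<^sub>k\<close> is the \<open>k\<close>-th component of \<open>exp \<zeta> = e\<^sup>\<xi> \<Sum>\<^sub>m N\<^sup>m / m!\<close>, since the residue of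
  \<open>e\<^sup>t / (t - \<xi>)\<^sup>m\<^sup>+\<^sup>1\<close> at \<open>\<xi>\<close> is \<open>e\<^sup>\<xi> / m!\<close> (\<open>line_integral_A_coeff\<close>).  For a merely rectifiable curve the residue
  is picked up by telescoping a primitive along the curve, the primitive of \<open>1 / (t - \<xi>)\<close> being a
  continuous branch of the logarithm, whose total increment is \<open>2\<pi>\<i>\<close> times the winding number
  (\<open>has_line_integral_residue\<close>).

  Finally, \<open>\<partial>/\<partial>x\<^sub>j\<close> acts on \<open>exp \<zeta>\<close> as multiplication by \<open>e\<^sub>j\<close> (\<open>vexp_has_vector_derivative\<close>), so that the
  differential operator acts as multiplication by the value of the characteristic polynomial at
  \<open>e\<^sub>1, \<dots>, e\<^sub>d\<close>, which is zero.  The same rule expresses all partial derivatives of the \<open>u\<^sub>k\<close> through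
  finitely many continuous functions \<open>u\<^sub>i\<close>, which gives the smoothness.
\<close>

section \<open>A residue theorem for rectifiable curves\<close>

lemma partition01_mono:
  assumes "partition01 n s" "i \<le> j" "j \<le> n"
  shows "s i \<le> s j"
  using assms(2,3)
proof (induction j rule: dec_induct)
  case (step j)
  then have "s i \<le> s j" by simp
  also have "s j \<le> s (Suc j)"
    using assms(1) step.prems by (simp add: partition01_def)
  finally show ?case .
qed simp

lemma partition01_mem:
  assumes "partition01 n s" "i \<le> n"
  shows "s i \<in> {0..1}"
  using partition01_mono[OF assms(1), of 0 i] partition01_mono[OF assms(1), of i n] assms
  by (simp add: partition01_def)

text \<open>
  The definite description in \<open>line_integral\<close> needs this.  It holds because the uniform partitions
  are arbitrarily fine, so that the defining condition is never vacuous.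
\<close>

lemma has_line_integral_unique:
  assumes "has_line_integral f J \<gamma>" "has_line_integral f K \<gamma>"
  shows "J = K"
proof (rule ccontr)
  assume "J \<noteq> K"
  define e where "e = norm (J - K) / 2"
  from \<open>J \<noteq> K\<close> have "e > 0" by (simp add: e_def)
  obtain d1 where d1: "d1 > 0" "\<And>n s \<tau>. partition01 n s \<Longrightarrow>
      (\<forall>i<n. s (Suc i) - s i < d1 \<and> s i \<le> \<tau> i \<and> \<tau> i \<le> s (Suc i)) \<Longrightarrow>
      norm ((\<Sum>i<n. f (\<gamma> (\<tau> i)) * (\<gamma> (s (Suc i)) - \<gamma> (s i))) - J) < e"
    using assms(1) \<open>e > 0\<close> unfolding has_line_integral_def by meson
  obtain d2 where d2: "d2 > 0" "\<And>n s \<tau>. partition01 n s \<Longrightarrow>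
      (\<forall>i<n. s (Suc i) - s i < d2 \<and> s i \<le> \<tau> i \<and> \<tau> i \<le> s (Suc i)) \<Longrightarrow>
      norm ((\<Sum>i<n. f (\<gamma> (\<tau> i)) * (\<gamma> (s (Suc i)) - \<gamma> (s i))) - K) < e"
    using assms(2) \<open>e > 0\<close> unfolding has_line_integral_def by meson
  obtain n where n: "inverse (of_nat (Suc n)) < min d1 d2"
    using reals_Archimedean[of "min d1 d2"] d1(1) d2(1) by auto
  define s where "s i = real i / real (Suc n)" for i
  have part: "partition01 (Suc n) s"
    by (auto simp: partition01_def s_def divide_simps)
  have "s (Suc i) - s i = inverse (of_nat (Suc n))" for i
    by (simp add: s_def divide_simps)
  then have fine: "s (Suc i) - s i < d1" "s (Suc i) - s i < d2" "s i \<le> s (Suc i)" for i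
    using n by (auto simp: s_def divide_simps)
  define R where "R = (\<Sum>i<Suc n. f (\<gamma> (s i)) * (\<gamma> (s (Suc i)) - \<gamma> (s i)))"
  have "norm (R - J) < e" "norm (R - K) < e"
    using d1(2)[OF part, of s] d2(2)[OF part, of s] fine unfolding R_def by blast+
  then have "norm ((R - K) - (R - J)) < e + e"
    by (metis add_strict_mono norm_triangle_ineq4 order_le_less_trans)
  then show False by (simp add: e_def)
qed

lemma line_integral_eqI: "has_line_integral f J \<gamma> \<Longrightarrow> line_integral f \<gamma> = J"
  unfolding line_integral_def by (blast intro: has_line_integral_unique)

text \<open>
  A path \<open>Q\<close> that is locally \<open>F \<circ> \<gamma>\<close> for primitives \<open>F\<close> of \<open>f\<close> plays the role of a primitive along \<open>\<gamma>\<close>,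
  even if \<open>f\<close> has no primitive near the whole curve.  On short parameter intervals the increment of
  \<open>Q\<close> differs from \<open>f (\<gamma> \<tau>) (\<gamma> s' - \<gamma> s)\<close> by at most \<open>e \<bar>\<gamma> s' - \<gamma> s\<bar>\<close>; a Lebesgue number makes this uniform
  in the position, and summation bounds the total error by \<open>e\<close> times the length.
\<close>

lemma has_line_integral_local_primitive:
  assumes rect: "rectifiable_path \<gamma>"
    and loc: "\<And>t0. t0 \<in> {0..1} \<Longrightarrow> \<exists>r>0. \<exists>F. (\<forall>w\<in>ball (\<gamma> t0) r. (F has_field_derivative f w) (at w)) \<and>
              (\<exists>d>0. \<forall>t\<in>{0..1}. dist t0 t < d \<longrightarrow> Q t = F (\<gamma> t))"
  shows "has_line_integral f (Q 1 - Q 0) \<gamma>"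
proof -
  have path: "continuous_on {0..1} \<gamma>"
    using rect by (simp add: rectifiable_path_def path_def)
  obtain L where L: "\<And>n s. partition01 n s \<Longrightarrow> (\<Sum>i<n. dist (\<gamma> (s i)) (\<gamma> (s (Suc i)))) \<le> L"
    using rect by (auto simp: rectifiable_path_def)
  have L0: "L \<ge> 0"
    using L[of 1 "\<lambda>i. real i"] by (simp add: partition01_def order_trans[OF zero_le_dist])
  have close: "\<exists>d>0. \<forall>s\<in>{0..1}. \<forall>\<tau>\<in>{0..1}. \<forall>s'\<in>{0..1}. s \<in> ball t0 d \<longrightarrow> \<tau> \<in> ball t0 d \<longrightarrow> s' \<in> ball t0 d \<longrightarrow>
      norm (Q s' - Q s - f (\<gamma> \<tau>) * (\<gamma> s' - \<gamma> s)) \<le> e * norm (\<gamma> s' - \<gamma> s)"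
    if "e > 0" "t0 \<in> {0..1}" for e t0
  proof -
    obtain r F d1 where r: "r > 0" and F: "\<And>w. w \<in> ball (\<gamma> t0) r \<Longrightarrow> (F has_field_derivative f w) (at w)"
      and d1: "d1 > 0" and Q: "\<And>t. t \<in> {0..1} \<Longrightarrow> dist t0 t < d1 \<Longrightarrow> Q t = F (\<gamma> t)"
      using loc[OF \<open>t0 \<in> {0..1}\<close>] by blast
    have "F holomorphic_on ball (\<gamma> t0) r"
      using F by (meson field_differentiable_at_within field_differentiable_def holomorphic_onI)
    then have "deriv F holomorphic_on ball (\<gamma> t0) r"
      by (simp add: holomorphic_deriv)
    then have "f holomorphic_on ball (\<gamma> t0) r"
      by (rule holomorphic_transform) (use F DERIV_imp_deriv in blast)
    then have "isCont f (\<gamma> t0)"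
      using r by (meson centre_in_ball continuous_on_eq_continuous_at holomorphic_on_imp_continuous_on open_ball)
    then obtain r1 where r1: "r1 > 0" "\<And>w. dist w (\<gamma> t0) < r1 \<Longrightarrow> dist (f w) (f (\<gamma> t0)) < e / 2"
      using \<open>e > 0\<close> unfolding continuous_at_eps_delta by (metis half_gt_zero)
    define B where "B = ball (\<gamma> t0) (min r r1)"
    obtain d2 where d2: "d2 > 0" "\<And>t. t \<in> {0..1} \<Longrightarrow> dist t t0 < d2 \<Longrightarrow> dist (\<gamma> t) (\<gamma> t0) < min r r1"
      using path \<open>t0 \<in> {0..1}\<close> r r1(1) unfolding continuous_on_iff by (metis min_less_iff_conj)
    have "norm (Q s' - Q s - f (\<gamma> \<tau>) * (\<gamma> s' - \<gamma> s)) \<le> e * norm (\<gamma> s' - \<gamma> s)"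
      if mem: "s \<in> {0..1}" "\<tau> \<in> {0..1}" "s' \<in> {0..1}"
        "s \<in> ball t0 (min d1 d2)" "\<tau> \<in> ball t0 (min d1 d2)" "s' \<in> ball t0 (min d1 d2)" for s \<tau> s'
    proof -
      have B: "\<gamma> s \<in> B" "\<gamma> \<tau> \<in> B" "\<gamma> s' \<in> B"
        using mem d2(2) by (auto simp: B_def dist_commute)
      define G where "G w = F w - f (\<gamma> \<tau>) * w" for w
      have "norm (G (\<gamma> s') - G (\<gamma> s)) \<le> e * norm (\<gamma> s' - \<gamma> s)"
      proof (rule field_differentiable_bound)
        show "convex B" by (simp add: B_def)
        show "(G has_field_derivative (f z - f (\<gamma> \<tau>))) (at z within B)" if "z \<in> B" for z
        proof -
          have "(F has_field_derivative f z) (at z within B)"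
            using that F by (simp add: B_def has_field_derivative_at_within)
          then show ?thesis unfolding G_def by (auto intro!: derivative_eq_intros)
        qed
        show "norm (f z - f (\<gamma> \<tau>)) \<le> e" if "z \<in> B" for z
        proof -
          have "dist (f z) (f (\<gamma> t0)) < e / 2" "dist (f (\<gamma> \<tau>)) (f (\<gamma> t0)) < e / 2"
            using that B(2) r1(2) by (auto simp: B_def dist_commute)
          then have "dist (f z) (f (\<gamma> \<tau>)) < e"
            by (rule dist_triangle_half_l)
          then show ?thesis by (simp add: dist_norm)
        qed
      qed (use B in auto)
      moreover have "G (\<gamma> s') - G (\<gamma> s) = Q s' - Q s - f (\<gamma> \<tau>) * (\<gamma> s' - \<gamma> s)"
        using Q[of s] Q[of s'] mem by (simp add: G_def algebra_simps)
      ultimately show ?thesis by simp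
    qed
    moreover have "min d1 d2 > 0" using d1 d2 by simp
    ultimately show ?thesis by blast
  qed
  show ?thesis
    unfolding has_line_integral_def
  proof (intro allI impI)
    fix \<epsilon> :: real assume "\<epsilon> > 0"
    \<comment> \<open>\<open>L + 1\<close> rather than \<open>L\<close>, as the length bound \<open>L\<close> may be zero\<close>
    define e where "e = \<epsilon> / (L + 1)"
    have e: "e > 0" "e * L < \<epsilon>"
      using \<open>\<epsilon> > 0\<close> L0 by (auto simp: e_def divide_simps)
    obtain d where d: "\<And>t0. t0 \<in> {0..1} \<Longrightarrow> d t0 > 0"
      "\<And>t0 s \<tau> s'. \<lbrakk>t0 \<in> {0..1}; s \<in> {0..1}; \<tau> \<in> {0..1}; s' \<in> {0..1}; s \<in> ball t0 (d t0);
        \<tau> \<in> ball t0 (d t0); s' \<in> ball t0 (d t0)\<rbrakk> \<Longrightarrow>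
      norm (Q s' - Q s - f (\<gamma> \<tau>) * (\<gamma> s' - \<gamma> s)) \<le> e * norm (\<gamma> s' - \<gamma> s)"
      using close[OF e(1)] by metis
    obtain \<delta> where \<delta>: "\<delta> > 0" "\<And>T. \<lbrakk>T \<subseteq> {0..1}; diameter T < \<delta>\<rbrakk> \<Longrightarrow> \<exists>B\<in>(\<lambda>t0. ball t0 (d t0)) ` {0..1::real}. T \<subseteq> B"
    proof (rule Lebesgue_number_lemma)
      show "{0..1::real} \<subseteq> \<Union> ((\<lambda>t0. ball t0 (d t0)) ` {0..1})"
        using d(1) by force
    qed auto
    show "\<exists>\<delta>>0. \<forall>n s \<tau>. partition01 n s \<and> (\<forall>i<n. s (Suc i) - s i < \<delta> \<and> s i \<le> \<tau> i \<and> \<tau> i \<le> s (Suc i)) \<longrightarrow>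
        norm ((\<Sum>i<n. f (\<gamma> (\<tau> i)) * (\<gamma> (s (Suc i)) - \<gamma> (s i))) - (Q 1 - Q 0)) < \<epsilon>"
    proof (rule exI[of _ \<delta>], intro conjI \<delta>(1) allI impI, elim conjE)
      fix n s \<tau>
      assume part: "partition01 n s"
        and fine: "\<forall>i<n. s (Suc i) - s i < \<delta> \<and> s i \<le> \<tau> i \<and> \<tau> i \<le> s (Suc i)"
      have step: "norm (Q (s (Suc i)) - Q (s i) - f (\<gamma> (\<tau> i)) * (\<gamma> (s (Suc i)) - \<gamma> (s i)))
           \<le> e * norm (\<gamma> (s (Suc i)) - \<gamma> (s i))" if "i < n" for i
      proof -
        have i: "s (Suc i) - s i < \<delta>" "s i \<le> \<tau> i" "\<tau> i \<le> s (Suc i)"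
          using fine that by auto
        have mem: "s i \<in> {0..1}" "s (Suc i) \<in> {0..1}"
          using partition01_mem[OF part, of i] partition01_mem[OF part, of "Suc i"] that by auto
        obtain t0 where t0: "t0 \<in> {0..1}" "{s i..s (Suc i)} \<subseteq> ball t0 (d t0)"
          using \<delta>(2)[of "{s i..s (Suc i)}"] mem i by (auto simp: diameter_closed_interval)
        have "s i \<in> {s i..s (Suc i)}" "\<tau> i \<in> {s i..s (Suc i)}" "s (Suc i) \<in> {s i..s (Suc i)}"
          using i by auto
        with t0(2) have "s i \<in> ball t0 (d t0)" "\<tau> i \<in> ball t0 (d t0)" "s (Suc i) \<in> ball t0 (d t0)"
          by blast+
        with mem i show ?thesis
          by (intro d(2)[OF t0(1)]) auto
      qed
      have "(\<Sum>i<n. Q (s (Suc i)) - Q (s i)) = Q 1 - Q 0"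
        using part by (simp add: sum_lessThan_telescope[of "\<lambda>i. Q (s i)"] partition01_def)
      then have "norm ((\<Sum>i<n. f (\<gamma> (\<tau> i)) * (\<gamma> (s (Suc i)) - \<gamma> (s i))) - (Q 1 - Q 0))
          = norm (\<Sum>i<n. Q (s (Suc i)) - Q (s i) - f (\<gamma> (\<tau> i)) * (\<gamma> (s (Suc i)) - \<gamma> (s i)))"
        by (simp add: sum_subtractf norm_minus_commute)
      also have "\<dots> \<le> (\<Sum>i<n. e * norm (\<gamma> (s (Suc i)) - \<gamma> (s i)))"
        by (rule sum_norm_le) (use step in auto)
      also have "\<dots> = e * (\<Sum>i<n. dist (\<gamma> (s i)) (\<gamma> (s (Suc i))))"
        by (simp add: sum_distrib_left dist_norm norm_minus_commute)
      also have "\<dots> \<le> e * L"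
        using L[OF part] e(1) by (intro mult_left_mono) auto
      finally show "norm ((\<Sum>i<n. f (\<gamma> (\<tau> i)) * (\<gamma> (s (Suc i)) - \<gamma> (s i))) - (Q 1 - Q 0)) < \<epsilon>"
        using e(2) by linarith
    qed
  qed
qed

text \<open>
  The hypothesis says that \<open>f\<close> is, up to an exact derivative, a simple pole with residue \<open>c\<close>.  The
  exact part contributes nothing because the curve is closed; the pole is integrated along a
  continuous logarithm \<open>q\<close> of \<open>\<gamma> - z\<close>, which near each parameter is a branch of \<open>Ln\<close> composed with \<open>\<gamma>\<close>.
\<close>

theorem has_line_integral_residue:
  assumes rect: "rectifiable_path \<gamma>" and closed: "pathfinish \<gamma> = pathstart \<gamma>"
    and z: "z \<notin> path_image \<gamma>"
    and H: "\<And>w. w \<noteq> z \<Longrightarrow> (H has_field_derivative f w - c / (w - z)) (at w)"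
  shows "has_line_integral f (2 * of_real pi * \<i> * c * winding_number \<gamma> z) \<gamma>"
proof -
  have "path \<gamma>" using rect by (simp add: rectifiable_path_def)
  then obtain q where q: "path q" "pathfinish q - pathstart q = 2 * of_real pi * \<i> * winding_number \<gamma> z"
    "\<And>t. t \<in> {0..1} \<Longrightarrow> \<gamma> t = z + exp (q t)"
    using winding_number_as_continuous_log[of \<gamma> z] z by blast
  define Q where "Q t = H (\<gamma> t) + c * q t" for t
  have "has_line_integral f (Q 1 - Q 0) \<gamma>"
  proof (rule has_line_integral_local_primitive[OF rect])
    fix t0 :: real assume t0: "t0 \<in> {0..1}"
    define w0 where "w0 = exp (q t0)"
    have w0: "\<gamma> t0 = z + w0" "w0 \<noteq> 0"
      using q(3)[OF t0] by (auto simp: w0_def)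
    \<comment> \<open>the disc of radius \<open>norm w0\<close> about \<open>\<gamma> t0\<close> avoids the pole, and \<open>(w - z) / w0\<close> maps it into the
      right half-plane, where \<open>Ln\<close> is holomorphic\<close>
    define F where "F w = H w + c * (q t0 + Ln ((w - z) / w0))" for w
    have "(F has_field_derivative f w) (at w)" if "w \<in> ball (\<gamma> t0) (norm w0)" for w
    proof -
      have "norm (w - z - w0) < norm w0"
        using that by (simp add: w0 dist_norm norm_minus_commute algebra_simps)
      then have lt: "norm ((w - z) / w0 - 1) < 1"
      proof -
        have "(w - z) / w0 - 1 = (w - z - w0) / w0"
          using w0(2) by (simp add: diff_divide_distrib)
        then show ?thesis
          using \<open>norm (w - z - w0) < norm w0\<close> w0(2) by (simp add: norm_divide)
      qed
      then have "Re ((w - z) / w0) > 0"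
        using abs_Re_le_cmod[of "(w - z) / w0 - 1"] by simp
      then have pos: "(w - z) / w0 \<notin> \<real>\<^sub>\<le>\<^sub>0"
        using complex_nonpos_Reals_iff by force
      then have wz: "w \<noteq> z" by auto
      have "((\<lambda>w. Ln ((w - z) / w0)) has_field_derivative 1 / (w - z)) (at w)"
        using pos w0(2) wz by (auto intro!: derivative_eq_intros simp: divide_simps)
      then have "(F has_field_derivative (f w - c / (w - z)) + c * (0 + 1 / (w - z))) (at w)"
        unfolding F_def by (intro DERIV_add DERIV_cmult DERIV_const H[OF wz])
      then show ?thesis by simp
    qed
    moreover have "\<exists>d>0. \<forall>t\<in>{0..1}. dist t0 t < d \<longrightarrow> Q t = F (\<gamma> t)"
    proof -
      have "continuous_on {0..1} q" using q(1) by (simp add: path_def)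
      then obtain d where d: "d > 0" "\<And>t. t \<in> {0..1} \<Longrightarrow> dist t t0 < d \<Longrightarrow> dist (q t) (q t0) < pi"
        using t0 pi_gt_zero unfolding continuous_on_iff by metis
      have "Q t = F (\<gamma> t)" if t: "t \<in> {0..1}" "dist t0 t < d" for t
      proof -
        have "norm (q t - q t0) < pi"
          using d(2)[of t] t by (simp add: dist_norm dist_commute norm_minus_commute abs_minus_commute)
        then have "\<bar>Im (q t - q t0)\<bar> < pi"
          using abs_Im_le_cmod order_le_less_trans by blast
        then have "Ln (exp (q t - q t0)) = q t - q t0"
          by (intro Ln_exp) auto
        then show ?thesis
          using q(3)[OF t(1)] by (simp add: Q_def F_def w0_def exp_diff)
      qed
      with d(1) show ?thesis by blast
    qed
    moreover have "norm w0 > 0" using w0(2) by simp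
    ultimately show "\<exists>r>0. \<exists>F. (\<forall>w\<in>ball (\<gamma> t0) r. (F has_field_derivative f w) (at w)) \<and>
              (\<exists>d>0. \<forall>t\<in>{0..1}. dist t0 t < d \<longrightarrow> Q t = F (\<gamma> t))"
      by blast
  qed
  moreover have "Q 1 - Q 0 = 2 * of_real pi * \<i> * c * winding_number \<gamma> z"
    using q(2) closed by (simp add: Q_def pathfinish_def pathstart_def algebra_simps)
  ultimately show ?thesis by simp
qed

text \<open>
  The residue of \<open>e\<^sup>w / (w - z)\<^sup>m\<^sup>+\<^sup>1\<close> is \<open>e\<^sup>z / m!\<close>.  The order of the pole is lowered by integration by
  parts, and for a simple pole the difference is the entire function \<open>(e\<^sup>w - e\<^sup>z) / (w - z)\<close>.
\<close>

lemma exp_pole_primitive: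
  fixes z :: complex
  shows "\<exists>H. \<forall>w. w \<noteq> z \<longrightarrow>
    (H has_field_derivative exp w / (w - z) ^ Suc m - exp z / fact m / (w - z)) (at w)"
proof (induction m)
  case 0
  define g where "g w = (if w = z then deriv exp z else (exp w - exp z) / (w - z))" for w
  have "g holomorphic_on UNIV"
    unfolding g_def by (rule pole_lemma) (auto intro: holomorphic_on_exp)
  then obtain H where H: "\<And>w. (H has_field_derivative g w) (at w within UNIV)"
    using holomorphic_convex_primitive'[of UNIV g] by auto
  have "(H has_field_derivative exp w / (w - z) ^ Suc 0 - exp z / fact 0 / (w - z)) (at w)" if "w \<noteq> z" for w
    using H[of w] that by (simp add: g_def diff_divide_distrib)
  then show ?case by blast
next
  case (Suc m)
  then obtain H where H: "\<And>w. w \<noteq> z \<Longrightarrow>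
    (H has_field_derivative exp w / (w - z) ^ Suc m - exp z / fact m / (w - z)) (at w)" by blast
  define c :: complex where "c = of_nat (Suc m)"
  have "c \<noteq> 0" unfolding c_def by (simp del: of_nat_Suc)
  define G where "G w = 1 / c * (H w - exp w / (w - z) ^ Suc m)" for w
  have "(G has_field_derivative exp w / (w - z) ^ Suc (Suc m) - exp z / fact (Suc m) / (w - z)) (at w)"
    if w: "w \<noteq> z" for w
  proof -
    define v where "v = w - z"
    have v: "v \<noteq> 0" using w by (auto simp: v_def)
    have "((\<lambda>w. (w - z) ^ Suc m) has_field_derivative c * v ^ m) (at w)"
    proof -
      have "((\<lambda>w. w - z) has_field_derivative 1) (at w)"
        by (auto intro!: derivative_eq_intros)
      from DERIV_power_Suc[OF this, of m] show ?thesis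
        by (simp only: v_def c_def of_nat_Suc mult_1)
    qed
    then have "((\<lambda>w. exp w / (w - z) ^ Suc m) has_field_derivative
        (exp w * v ^ Suc m - exp w * (c * v ^ m)) / (v ^ Suc m * v ^ Suc m)) (at w)"
      unfolding v_def by (intro DERIV_divide DERIV_exp) (use w in auto)
    also have "(exp w * v ^ Suc m - exp w * (c * v ^ m)) / (v ^ Suc m * v ^ Suc m)
         = exp w / v ^ Suc m - c * (exp w / v ^ Suc (Suc m))"
      using v by (simp add: field_simps)
    finally have "(G has_field_derivative 1 / c * ((exp w / v ^ Suc m - exp z / fact m / v) -
        (exp w / v ^ Suc m - c * (exp w / v ^ Suc (Suc m))))) (at w)"
      unfolding G_def using H[OF w] by (intro DERIV_cmult DERIV_diff) (simp_all add: v_def)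
    also have "1 / c * ((exp w / v ^ Suc m - exp z / fact m / v) - (exp w / v ^ Suc m - c * (exp w / v ^ Suc (Suc m))))
        = 1 / c * (c * (exp w / v ^ Suc (Suc m)) - exp z / fact m / v)"
      by simp
    also have "\<dots> = exp w / v ^ Suc (Suc m) - exp z / (c * fact m) / v"
      using \<open>c \<noteq> 0\<close> by (simp add: right_diff_distrib)
    also have "c * fact m = fact (Suc m)" by (simp add: c_def)
    finally show ?thesis by (simp add: v_def)
  qed
  then show ?case by blast
qed


section \<open>Formal vectors on a sequence of extensions\<close>

text \<open>
  The table extended to the unit \<open>I\<^sub>0\<close>.
\<close>

definition structure_constant :: "(nat \<Rightarrow> nat \<Rightarrow> nat \<Rightarrow> complex) \<Rightarrow> nat \<Rightarrow> nat \<Rightarrow> nat \<Rightarrow> complex" where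
  "structure_constant \<Upsilon> r s k =
     (if r = 0 then of_bool (s = k) else if s = 0 then of_bool (r = k) else \<Upsilon> r s k)"

text \<open>
  Restricting both sums to indices \<open>\<le> k\<close> loses nothing, since the table is triangular; thus the
  product of two infinite sequences needs no convergence.
\<close>

definition vmult :: "(nat \<Rightarrow> nat \<Rightarrow> nat \<Rightarrow> complex) \<Rightarrow> (nat \<Rightarrow> complex) \<Rightarrow> (nat \<Rightarrow> complex) \<Rightarrow> nat \<Rightarrow> complex" where
  "vmult \<Upsilon> c d k = (\<Sum>r\<le>k. \<Sum>s\<le>k. c r * d s * structure_constant \<Upsilon> r s k)"

definition vone :: "nat \<Rightarrow> complex" where
  "vone k = of_bool (k = 0)"

lemma vmult_cong:
  assumes "\<And>i. i \<le> k \<Longrightarrow> c i = c' i" "\<And>i. i \<le> k \<Longrightarrow> d i = d' i"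
  shows "vmult \<Upsilon> c d k = vmult \<Upsilon> c' d' k"
  unfolding vmult_def using assms by (intro sum.cong) auto

lemma vmult_sum_left:
  "vmult \<Upsilon> (\<lambda>r. \<Sum>i\<in>A. z i * f i r) d k = (\<Sum>i\<in>A. z i * vmult \<Upsilon> (f i) d k)"
proof -
  have "vmult \<Upsilon> (\<lambda>r. \<Sum>i\<in>A. z i * f i r) d k
      = (\<Sum>r\<le>k. \<Sum>s\<le>k. \<Sum>i\<in>A. z i * (f i r * d s * structure_constant \<Upsilon> r s k))"
    by (simp add: vmult_def sum_distrib_right mult.assoc)
  also have "\<dots> = (\<Sum>r\<le>k. \<Sum>i\<in>A. \<Sum>s\<le>k. z i * (f i r * d s * structure_constant \<Upsilon> r s k))"
    by (intro sum.cong refl sum.swap)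
  also have "\<dots> = (\<Sum>i\<in>A. \<Sum>r\<le>k. \<Sum>s\<le>k. z i * (f i r * d s * structure_constant \<Upsilon> r s k))"
    by (rule sum.swap)
  finally show ?thesis by (simp add: vmult_def sum_distrib_left)
qed

lemma vmult_scale_right: "vmult \<Upsilon> c (\<lambda>i. z * d i) k = z * vmult \<Upsilon> c d k"
  by (simp add: vmult_def sum_distrib_left mult_ac)

lemma vmult_add_left: "vmult \<Upsilon> (\<lambda>i. c i + c' i) d k = vmult \<Upsilon> c d k + vmult \<Upsilon> c' d k"
  by (simp add: vmult_def distrib_right sum.distrib)

lemma vmult_scale_left: "vmult \<Upsilon> (\<lambda>i. z * c i) d k = z * vmult \<Upsilon> c d k"
  by (simp add: vmult_def sum_distrib_left mult_ac)

lemma vmult_has_vector_derivative: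
  assumes "\<And>i. i \<le> k \<Longrightarrow> ((\<lambda>h. F h i) has_vector_derivative F' i) (at t)"
    and "\<And>i. i \<le> k \<Longrightarrow> ((\<lambda>h. G h i) has_vector_derivative G' i) (at t)"
  shows "((\<lambda>h. vmult \<Upsilon> (F h) (G h) k) has_vector_derivative
           vmult \<Upsilon> (F t) G' k + vmult \<Upsilon> F' (G t) k) (at t)"
proof -
  have "((\<lambda>h. vmult \<Upsilon> (F h) (G h) k) has_vector_derivative
      (\<Sum>r\<le>k. \<Sum>s\<le>k. (F t r * G' s + F' r * G t s) * structure_constant \<Upsilon> r s k)) (at t)"
    unfolding vmult_def
    by (intro has_vector_derivative_sum has_vector_derivative_mult_left has_vector_derivative_mult assms) auto
  then show ?thesis by (simp add: vmult_def distrib_right sum.distrib)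
qed

locale based_algebra = algebra complex_field M
  for M :: "(complex, 'a) module" +
  fixes b :: "nat \<Rightarrow> 'a" and n :: nat
  assumes basis: "is_basis M b n"
begin

abbreviation T where "T \<equiv> truncation M b n"

lemma complex_field_simps [simp]:
  "carrier complex_field = UNIV" "x \<otimes>\<^bsub>complex_field\<^esub> y = x * y" "x \<oplus>\<^bsub>complex_field\<^esub> y = x + y"
  "\<one>\<^bsub>complex_field\<^esub> = 1" "\<zero>\<^bsub>complex_field\<^esub> = 0"
  by (simp_all add: ring_of_type_algebra_def)

lemma b_closed [simp]: "r < n \<Longrightarrow> b r \<in> carrier M"
  using basis by (simp add: is_basis_def)

lemma smult_in_carrier [simp]: "x \<in> carrier M \<Longrightarrow> z \<odot>\<^bsub>M\<^esub> x \<in> carrier M"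
  by (rule smult_closed) simp

lemma T_closed [simp]: "T c \<in> carrier M"
  unfolding truncation_def by (rule M.finsum_closed) auto

lemma T_cong: "(\<And>r. r < n \<Longrightarrow> c r = d r) \<Longrightarrow> T c = T d"
  unfolding truncation_def by (rule M.finsum_cong') auto

lemma T_zero: "T (\<lambda>r. 0) = \<zero>\<^bsub>M\<^esub>"
proof -
  have "T (\<lambda>r. 0) = (\<Oplus>\<^bsub>M\<^esub> r\<in>{..<n}. \<zero>\<^bsub>M\<^esub>)"
    unfolding truncation_def by (rule M.finsum_cong') (use smult_l_null in auto)
  then show ?thesis by simp
qed

lemma T_add: "T (\<lambda>r. c r + d r) = T c \<oplus>\<^bsub>M\<^esub> T d"
proof -
  have "T (\<lambda>r. c r + d r) = (\<Oplus>\<^bsub>M\<^esub> r\<in>{..<n}. c r \<odot>\<^bsub>M\<^esub> b r \<oplus>\<^bsub>M\<^esub> d r \<odot>\<^bsub>M\<^esub> b r)"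
    unfolding truncation_def by (rule M.finsum_cong') (use smult_l_distr in auto)
  also have "\<dots> = T c \<oplus>\<^bsub>M\<^esub> T d"
    unfolding truncation_def by (rule M.finsum_addf) auto
  finally show ?thesis .
qed

lemma T_smult: "T (\<lambda>r. z * c r) = z \<odot>\<^bsub>M\<^esub> T c"
proof -
  have "z \<odot>\<^bsub>M\<^esub> T c = (\<Oplus>\<^bsub>M\<^esub> r\<in>{..<n}. z \<odot>\<^bsub>M\<^esub> (c r \<odot>\<^bsub>M\<^esub> b r))"
    unfolding truncation_def by (rule finsum_smult_ldistr) auto
  also have "\<dots> = T (\<lambda>r. z * c r)"
    unfolding truncation_def by (rule M.finsum_cong') (use smult_assoc1 in auto)
  finally show ?thesis by simp
qed

lemma T_sum: "finite A \<Longrightarrow> T (\<lambda>r. \<Sum>i\<in>A. f i r) = (\<Oplus>\<^bsub>M\<^esub> i\<in>A. T (f i))"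
  by (induction A rule: finite_induct) (simp_all add: T_zero T_add)

lemma T_eqD:
  assumes "T c = T d" "r < n"
  shows "c r = d r"
proof -
  have "T c = T (\<lambda>r. d r + (c r - d r))" by simp
  also have "\<dots> = T d \<oplus>\<^bsub>M\<^esub> T (\<lambda>r. c r - d r)" by (rule T_add)
  finally have "T (\<lambda>r. c r - d r) = \<zero>\<^bsub>M\<^esub>"
    using assms(1) by (simp add: M.add.r_cancel_one')
  then show ?thesis using basis assms(2) by (auto simp: is_basis_def)
qed

lemma T_unit_vector:
  assumes "s < n"
  shows "T (\<lambda>r. of_bool (s = r)) = b s"
proof -
  have "T (\<lambda>r. of_bool (s = r)) = (\<Oplus>\<^bsub>M\<^esub> r\<in>{..<n}. if s = r then b r else \<zero>\<^bsub>M\<^esub>)"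
    unfolding truncation_def
  proof (rule M.finsum_cong')
    fix r assume "r \<in> {..<n}"
    then show "of_bool (s = r) \<odot>\<^bsub>M\<^esub> b r = (if s = r then b r else \<zero>\<^bsub>M\<^esub>)"
      using smult_one[of "b r"] smult_l_null[of "b r"] by auto
  qed auto
  then show ?thesis using assms by (simp add: M.finsum_singleton Pi_def)
qed

text \<open>
  Truncation is multiplicative because the components \<open>\<ge> n\<close> of the factors do not affect those \<open>< n\<close> of
  the product.
\<close>

lemma T_mult:
  assumes table: "\<And>r s. r < n \<Longrightarrow> s < n \<Longrightarrow> b r \<otimes>\<^bsub>M\<^esub> b s = T (structure_constant \<Upsilon> r s)"
    and tri: "\<And>r s k. k < max r s \<Longrightarrow> structure_constant \<Upsilon> r s k = 0"
  shows "T c \<otimes>\<^bsub>M\<^esub> T d = T (vmult \<Upsilon> c d)"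
proof -
  have "T c \<otimes>\<^bsub>M\<^esub> T d = (\<Oplus>\<^bsub>M\<^esub> r\<in>{..<n}. (c r \<odot>\<^bsub>M\<^esub> b r) \<otimes>\<^bsub>M\<^esub> T d)"
    by (subst (1) truncation_def, rule finsum_ldistr) auto
  also have "\<dots> = (\<Oplus>\<^bsub>M\<^esub> r\<in>{..<n}. T (\<lambda>k. \<Sum>s<n. c r * d s * structure_constant \<Upsilon> r s k))"
  proof (rule M.finsum_cong')
    fix r assume "r \<in> {..<n}"
    then have r: "r < n" by simp
    have "(c r \<odot>\<^bsub>M\<^esub> b r) \<otimes>\<^bsub>M\<^esub> T d = (\<Oplus>\<^bsub>M\<^esub> s\<in>{..<n}. (c r \<odot>\<^bsub>M\<^esub> b r) \<otimes>\<^bsub>M\<^esub> (d s \<odot>\<^bsub>M\<^esub> b s))"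
      by (subst truncation_def, rule finsum_rdistr) (use r in auto)
    also have "\<dots> = (\<Oplus>\<^bsub>M\<^esub> s\<in>{..<n}. T (\<lambda>k. c r * d s * structure_constant \<Upsilon> r s k))"
    proof (rule M.finsum_cong')
      fix s assume "s \<in> {..<n}"
      then have s: "s < n" by simp
      have "(c r \<odot>\<^bsub>M\<^esub> b r) \<otimes>\<^bsub>M\<^esub> (d s \<odot>\<^bsub>M\<^esub> b s) = c r \<odot>\<^bsub>M\<^esub> (d s \<odot>\<^bsub>M\<^esub> (b s \<otimes>\<^bsub>M\<^esub> b r))"
        using r s by (simp add: smult_assoc2 m_comm[of "b r"])
      also have "\<dots> = (c r * d s) \<odot>\<^bsub>M\<^esub> (b r \<otimes>\<^bsub>M\<^esub> b s)"
        using r s smult_assoc1[of "c r" "d s"] by (simp add: m_comm[of "b r"])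
      finally show "(c r \<odot>\<^bsub>M\<^esub> b r) \<otimes>\<^bsub>M\<^esub> (d s \<odot>\<^bsub>M\<^esub> b s) = T (\<lambda>k. c r * d s * structure_constant \<Upsilon> r s k)"
        using table[OF r s] by (simp add: T_smult)
    qed auto
    finally show "(c r \<odot>\<^bsub>M\<^esub> b r) \<otimes>\<^bsub>M\<^esub> T d = T (\<lambda>k. \<Sum>s<n. c r * d s * structure_constant \<Upsilon> r s k)"
      by (simp add: T_sum)
  qed auto
  also have "\<dots> = T (\<lambda>k. \<Sum>r<n. \<Sum>s<n. c r * d s * structure_constant \<Upsilon> r s k)"
    by (simp add: T_sum)
  also have "\<dots> = T (vmult \<Upsilon> c d)"
  proof (rule T_cong)
    fix k assume k: "k < n"
    have "(\<Sum>s<n. c r * d s * structure_constant \<Upsilon> r s k) = (\<Sum>s\<le>k. c r * d s * structure_constant \<Upsilon> r s k)" for r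
      by (rule sum.mono_neutral_right) (use k tri in auto)
    moreover have "(\<Sum>r<n. \<Sum>s\<le>k. c r * d s * structure_constant \<Upsilon> r s k) = vmult \<Upsilon> c d k"
      unfolding vmult_def by (rule sum.mono_neutral_right) (use k tri in auto)
    ultimately show "(\<Sum>r<n. \<Sum>s<n. c r * d s * structure_constant \<Upsilon> r s k) = vmult \<Upsilon> c d k" by simp
  qed
  finally show ?thesis .
qed

end

lemma structure_constant_triangular:
  assumes "extension_sequence \<E> I \<Upsilon>" "k < max r s"
  shows "structure_constant \<Upsilon> r s k = 0"
  using assms by (auto simp: structure_constant_def extension_sequence_def max_def split: if_splits)

lemma extension_sequence_based_algebra:
  assumes "extension_sequence \<E> I \<Upsilon>" "n \<ge> 2"
  shows "based_algebra (\<E> n) (I n) n"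
  using assms by (auto simp: based_algebra_def based_algebra_axioms_def extension_sequence_def)

lemma extension_sequence_table:
  assumes ext: "extension_sequence \<E> I \<Upsilon>" and n: "n \<ge> 2" and rs: "r < n" "s < n"
  shows "I n r \<otimes>\<^bsub>\<E> n\<^esub> I n s = truncation (\<E> n) (I n) n (structure_constant \<Upsilon> r s)"
proof -
  interpret based_algebra "\<E> n" "I n" n
    by (rule extension_sequence_based_algebra) fact+
  have one: "I n 0 = \<one>\<^bsub>\<E> n\<^esub>" using ext n by (auto simp: extension_sequence_def)
  consider "r = 0" | "s = 0" "r \<noteq> 0" | "r \<noteq> 0" "s \<noteq> 0" by blast
  then show ?thesis
  proof cases
    case 1
    then show ?thesis using rs one T_unit_vector[of s] by (simp add: structure_constant_def[abs_def])
  next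
    case 2
    then show ?thesis using rs one T_unit_vector[of r] by (simp add: structure_constant_def[abs_def])
  next
    case 3
    have "I n r \<otimes>\<^bsub>\<E> n\<^esub> I n s = (\<Oplus>\<^bsub>\<E> n\<^esub> k\<in>{max r s + 1..n-1}. \<Upsilon> r s k \<odot>\<^bsub>\<E> n\<^esub> I n k)"
      using ext n rs 3 by (auto simp: extension_sequence_def)
    also have "\<dots> = (\<Oplus>\<^bsub>\<E> n\<^esub> k\<in>{..<n}. structure_constant \<Upsilon> r s k \<odot>\<^bsub>\<E> n\<^esub> I n k)"
    proof (rule M.add.finprod_mono_neutral_cong_left)
      show "{max r s + 1..n - 1} \<subseteq> {..<n}" using n by auto
      fix k assume k: "k \<in> {..<n} - {max r s + 1..n - 1}"
      then have "k \<le> max r s" "k < n" by auto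
      then have "structure_constant \<Upsilon> r s k = 0"
        using ext 3 unfolding extension_sequence_def structure_constant_def by auto
      then show "structure_constant \<Upsilon> r s k \<odot>\<^bsub>\<E> n\<^esub> I n k = \<zero>\<^bsub>\<E> n\<^esub>"
        using k smult_l_null[of "I n k"] by simp
    qed (use 3 in \<open>auto simp: structure_constant_def\<close>)
    finally show ?thesis by (simp add: truncation_def)
  qed
qed

lemma truncation_vmult:
  assumes "extension_sequence \<E> I \<Upsilon>" "n \<ge> 2"
  shows "truncation (\<E> n) (I n) n (vmult \<Upsilon> c d) =
         truncation (\<E> n) (I n) n c \<otimes>\<^bsub>\<E> n\<^esub> truncation (\<E> n) (I n) n d"
proof -
  interpret based_algebra "\<E> n" "I n" n
    by (rule extension_sequence_based_algebra) fact+
  show ?thesis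
    using T_mult[OF extension_sequence_table[OF assms] structure_constant_triangular[OF assms(1)]] by simp
qed

lemma truncation_vone:
  assumes "extension_sequence \<E> I \<Upsilon>" "n \<ge> 2"
  shows "truncation (\<E> n) (I n) n vone = \<one>\<^bsub>\<E> n\<^esub>"
proof -
  interpret based_algebra "\<E> n" "I n" n
    by (rule extension_sequence_based_algebra) fact+
  have "vone = (\<lambda>r. of_bool (0 = r))" by (auto simp: vone_def)
  then show ?thesis
    using T_unit_vector[of 0] assms by (auto simp: extension_sequence_def)
qed

text \<open>
  This transfers identities from all the algebras of the sequence at once: the component \<open>k\<close> is seen
  in every algebra of dimension greater than \<open>k\<close>.
\<close>

lemma truncations_eqI:
  assumes "extension_sequence \<E> I \<Upsilon>"
    and "\<And>n. n \<ge> 2 \<Longrightarrow> truncation (\<E> n) (I n) n c = truncation (\<E> n) (I n) n d"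
  shows "c = d"
proof
  fix k
  interpret based_algebra "\<E> (k + 2)" "I (k + 2)" "k + 2"
    by (rule extension_sequence_based_algebra) (use assms in auto)
  show "c k = d k" by (rule T_eqD) (use assms in auto)
qed

locale extensions =
  fixes \<E> :: "nat \<Rightarrow> (complex, 'a) module" and I \<Upsilon>
  assumes seq: "extension_sequence \<E> I \<Upsilon>"
begin

abbreviation star (infixl "\<star>" 70) where "c \<star> d \<equiv> vmult \<Upsilon> c d"

lemma truncation_in_carrier: "n \<ge> 2 \<Longrightarrow> truncation (\<E> n) (I n) n c \<in> carrier (\<E> n)"
  by (rule based_algebra.T_closed[OF extension_sequence_based_algebra[OF seq]])

lemma algebra_comm_monoid: "n \<ge> 2 \<Longrightarrow> comm_monoid (\<E> n)"
  using seq algebra.axioms(2)[of complex_field "\<E> n"] 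
  by (auto simp: extension_sequence_def cring_def)

lemma vmult_commute: "c \<star> d = d \<star> c"
proof (rule truncations_eqI[OF seq])
  fix n :: nat assume n: "n \<ge> 2"
  interpret comm_monoid "\<E> n" by (rule algebra_comm_monoid[OF n])
  show "truncation (\<E> n) (I n) n (c \<star> d) = truncation (\<E> n) (I n) n (d \<star> c)"
    by (simp add: truncation_vmult[OF seq n] truncation_in_carrier[OF n] m_comm)
qed

lemma vmult_assoc: "c \<star> d \<star> e = c \<star> (d \<star> e)"
proof (rule truncations_eqI[OF seq])
  fix n :: nat assume n: "n \<ge> 2"
  interpret comm_monoid "\<E> n" by (rule algebra_comm_monoid[OF n])
  show "truncation (\<E> n) (I n) n (c \<star> d \<star> e) = truncation (\<E> n) (I n) n (c \<star> (d \<star> e))"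
    by (simp add: truncation_vmult[OF seq n] truncation_in_carrier[OF n] m_assoc)
qed

lemma vmult_vone: "vone \<star> c = c"
proof (rule truncations_eqI[OF seq])
  fix n :: nat assume n: "n \<ge> 2"
  interpret comm_monoid "\<E> n" by (rule algebra_comm_monoid[OF n])
  show "truncation (\<E> n) (I n) n (vone \<star> c) = truncation (\<E> n) (I n) n c"
    by (simp add: truncation_vmult[OF seq n] truncation_vone[OF seq n] truncation_in_carrier[OF n])
qed

lemma vmult_left_commute: "c \<star> (d \<star> e) = d \<star> (c \<star> e)"
  by (metis vmult_assoc vmult_commute)

text \<open>
  The factors are multiplied in the order in which \<open>mixed_partial\<close> applies the derivatives, so that the
  two iterations can be compared by one induction.
\<close>

definition monomial :: "('d::{finite,linorder} \<Rightarrow> nat \<Rightarrow> complex) \<Rightarrow> ('d \<Rightarrow> nat) \<Rightarrow> nat \<Rightarrow> complex" where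
  "monomial a \<alpha> = foldr (\<lambda>j. ((\<star>) (a j)) ^^ \<alpha> j) (sorted_list_of_set UNIV) vone"

lemma truncation_funpow:
  assumes n: "n \<ge> 2"
  shows "truncation (\<E> n) (I n) n ((((\<star>) c) ^^ m) d) =
    truncation (\<E> n) (I n) n c [^]\<^bsub>\<E> n\<^esub> m \<otimes>\<^bsub>\<E> n\<^esub> truncation (\<E> n) (I n) n d"
proof -
  interpret comm_monoid "\<E> n" by (rule algebra_comm_monoid[OF n])
  show ?thesis
    by (induction m) (simp_all add: truncation_vmult[OF seq n] truncation_in_carrier[OF n] m_comm m_lcomm m_assoc)
qed

lemma truncation_monomial:
  assumes n: "n \<ge> 2"
  shows "truncation (\<E> n) (I n) n (monomial a \<alpha>) =
    (\<Otimes>\<^bsub>\<E> n\<^esub> j\<in>UNIV. truncation (\<E> n) (I n) n (a j) [^]\<^bsub>\<E> n\<^esub> \<alpha> j)"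
proof -
  interpret comm_monoid "\<E> n" by (rule algebra_comm_monoid[OF n])
  have "truncation (\<E> n) (I n) n (foldr (\<lambda>j. ((\<star>) (a j)) ^^ \<alpha> j) xs vone) =
    (\<Otimes>\<^bsub>\<E> n\<^esub> j\<in>set xs. truncation (\<E> n) (I n) n (a j) [^]\<^bsub>\<E> n\<^esub> \<alpha> j)" if "distinct xs" for xs
    using that
    by (induction xs) (simp_all add: truncation_vone[OF seq n] truncation_funpow[OF n] truncation_in_carrier[OF n])
  from this[of "sorted_list_of_set UNIV"] show ?thesis
    by (simp add: monomial_def)
qed

lemma characteristic_equation:
  fixes a :: "'d::{finite,linorder} \<Rightarrow> nat \<Rightarrow> complex"
  assumes "\<And>n. n \<ge> 2 \<Longrightarrow> characteristic_value (\<E> n) p C (\<lambda>j. truncation (\<E> n) (I n) n (a j)) = \<zero>\<^bsub>\<E> n\<^esub>"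
  shows "(\<Sum>k\<le>p. \<Sum>\<alpha>\<in>multi_indices k. complex_of_real (C k \<alpha>) * monomial a \<alpha> i) = 0"
proof -
  have fin: "finite (multi_indices k :: ('d \<Rightarrow> nat) set)" for k
  proof (rule finite_subset)
    show "multi_indices k \<subseteq> Pi\<^sub>E UNIV (\<lambda>_::'d. {..k})"
      by (auto simp: multi_indices_def intro: member_le_sum)
  qed (auto intro: finite_PiE)
  have "(\<lambda>i. \<Sum>k\<le>p. \<Sum>\<alpha>\<in>multi_indices k. complex_of_real (C k \<alpha>) * monomial a \<alpha> i) = (\<lambda>i. 0)"
  proof (rule truncations_eqI[OF seq])
    fix n :: nat assume n: "n \<ge> 2"
    interpret based_algebra "\<E> n" "I n" n
      by (rule extension_sequence_based_algebra[OF seq n])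
    show "T (\<lambda>i. \<Sum>k\<le>p. \<Sum>\<alpha>\<in>multi_indices k. complex_of_real (C k \<alpha>) * monomial a \<alpha> i) = T (\<lambda>i. 0)"
      using assms[OF n] by (simp add: T_sum fin T_smult T_zero truncation_monomial[OF n] characteristic_value_def)
  qed
  then show ?thesis by (rule fun_cong)
qed

end


section \<open>The resolvent and the exponential\<close>

definition nilpotent_part :: "(nat \<Rightarrow> complex) \<Rightarrow> nat \<Rightarrow> complex" where
  "nilpotent_part \<xi> k = (if k = 0 then 0 else \<xi> k)"

context extensions
begin

definition nilpotent_power :: "(nat \<Rightarrow> complex) \<Rightarrow> nat \<Rightarrow> nat \<Rightarrow> complex" where
  "nilpotent_power \<xi> m = (((\<star>) (nilpotent_part \<xi>)) ^^ m) vone"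

lemma nilpotent_power_0: "nilpotent_power \<xi> 0 = vone" by (simp add: nilpotent_power_def)
lemma nilpotent_power_Suc: "nilpotent_power \<xi> (Suc m) = nilpotent_part \<xi> \<star> nilpotent_power \<xi> m" by (simp add: nilpotent_power_def)

definition vexp :: "(nat \<Rightarrow> complex) \<Rightarrow> nat \<Rightarrow> complex" where
  "vexp \<xi> k = exp (\<xi> 0) * (\<Sum>m\<le>k. nilpotent_power \<xi> m k / fact m)"

text \<open>
  Multiplication by \<open>N\<close> produces the quantities \<open>B\<^sub>r\<^sub>,\<^sub>k\<close>, and the component \<open>k\<close> of the product
  involves only the components \<open>< k\<close> of the factor \<open>d\<close>.  This is the source both of the nilpotency and
  of the recursion for the \<open>A\<^sub>k\<close>.
\<close>

lemma nilpotent_part_vmult: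
  "(nilpotent_part \<xi> \<star> d) k = (if k = 0 then 0 else \<xi> k * d 0 + (\<Sum>r=1..k-1. d r * B_coeff \<Upsilon> \<xi> r k))"
proof (cases "k = 0")
  case False
  have zero: "\<Upsilon> r s k = 0" if "r \<ge> 1" "s \<ge> 1" "k \<le> max r s" for r s
    using seq that unfolding extension_sequence_def by blast
  define g where "g r = (\<Sum>s\<le>k. d r * nilpotent_part \<xi> s * structure_constant \<Upsilon> r s k)" for r
  have "g 0 = (\<Sum>s\<in>{k}. d 0 * nilpotent_part \<xi> s)"
    unfolding g_def
    by (rule sum.mono_neutral_cong_right) (auto simp: structure_constant_def)
  then have g0: "g 0 = \<xi> k * d 0" using False by (simp add: nilpotent_part_def)
  have g: "g r = d r * B_coeff \<Upsilon> \<xi> r k" if "r \<ge> 1" for r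
  proof -
    have "g r = (\<Sum>s=1..k-1. d r * (\<xi> s * \<Upsilon> r s k))"
      unfolding g_def
    proof (rule sum.mono_neutral_cong_right)
      show "\<forall>s\<in>{..k} - {1..k - 1}. d r * nilpotent_part \<xi> s * structure_constant \<Upsilon> r s k = 0"
      proof
        fix s assume "s \<in> {..k} - {1..k - 1}"
        then have "s = 0 \<or> s = k" by auto
        then show "d r * nilpotent_part \<xi> s * structure_constant \<Upsilon> r s k = 0"
          using zero[of r k] that False by (auto simp: nilpotent_part_def structure_constant_def)
      qed
    qed (use that in \<open>auto simp: nilpotent_part_def structure_constant_def\<close>)
    then show ?thesis by (simp add: B_coeff_def sum_distrib_left)
  qed
  have "(nilpotent_part \<xi> \<star> d) k = (\<Sum>r\<le>k. g r)"
    by (subst vmult_commute) (simp add: vmult_def g_def)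
  also have "\<dots> = (\<Sum>r\<in>insert 0 {1..k-1}. g r)"
  proof (rule sum.mono_neutral_right)
    show "\<forall>r\<in>{..k} - insert 0 {1..k - 1}. g r = 0"
    proof
      fix r assume "r \<in> {..k} - insert 0 {1..k - 1}"
      then have "r = k" by auto
      then show "g r = 0" using g[of r] False zero[of k] by (auto simp: B_coeff_def)
    qed
  qed (use False in auto)
  also have "\<dots> = \<xi> k * d 0 + (\<Sum>r=1..k-1. d r * B_coeff \<Upsilon> \<xi> r k)"
    using g g0 by simp
  finally show ?thesis using False by simp
qed (simp add: vmult_def nilpotent_part_def)

lemma nilpotent_power_eq_0: "k < m \<Longrightarrow> nilpotent_power \<xi> m k = 0"
proof (induction m arbitrary: k)
  case (Suc m)
  then show ?case by (cases "m = 0") (auto simp: nilpotent_power_Suc nilpotent_part_vmult intro!: sum.neutral)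
qed simp

text \<open>
  By nilpotency the exponential series may be cut at any \<open>L \<ge> k\<close>.  A common bound for all
  components up to \<open>k\<close> is what allows multiplying the series termwise.
\<close>

lemma vexp_eq:
  assumes "k \<le> L"
  shows "vexp \<xi> k = exp (\<xi> 0) * (\<Sum>m\<le>L. nilpotent_power \<xi> m k / fact m)"
proof -
  have "(\<Sum>m\<le>k. nilpotent_power \<xi> m k / fact m) = (\<Sum>m\<le>L. nilpotent_power \<xi> m k / fact m)"
    by (rule sum.mono_neutral_left) (use assms in \<open>auto simp: nilpotent_power_eq_0\<close>)
  then show ?thesis by (simp add: vexp_def)
qed

text \<open>
  Both sides satisfy the recursion expressing that \<open>(t - \<xi> - N) \<star> (\<Sum>\<^sub>k A\<^sub>k I\<^sub>k)\<close> is the unit.  At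
  \<open>t = \<xi>\<close> both sides are \<open>0\<close>, because \<open>1 / 0 = 0\<close>.
\<close>

lemma A_coeff_eq:
  assumes "k \<le> L"
  shows "A_coeff \<Upsilon> \<xi> t k = (\<Sum>m\<le>L. nilpotent_power \<xi> m k * (1 / (t - \<xi> 0)) ^ Suc m)"
  using assms
proof (induction k arbitrary: L rule: less_induct)
  case (less k)
  define z where "z = 1 / (t - \<xi> 0)"
  show ?case
  proof (cases "k = 0")
    case True
    have "(\<Sum>m\<le>L. nilpotent_power \<xi> m 0 * z ^ Suc m) = (\<Sum>m\<in>{0}. nilpotent_power \<xi> m 0 * z ^ Suc m)"
      by (rule sum.mono_neutral_right) (auto simp: nilpotent_power_eq_0)
    then show ?thesis using True by (simp add: nilpotent_power_0 vone_def z_def)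
  next
    case False
    then obtain L' where L': "L = Suc L'" "k \<le> Suc L'" using less.prems by (cases L) auto
    have A0: "(\<Sum>m\<le>L'. nilpotent_power \<xi> m 0 * z ^ Suc m) = z"
      using less.IH[of 0 L'] False by (simp add: z_def)
    have "A_coeff \<Upsilon> \<xi> t k = \<xi> k * z\<^sup>2 + z * (\<Sum>r=1..k-1. A_coeff \<Upsilon> \<xi> t r * B_coeff \<Upsilon> \<xi> r k)"
      using False by (cases "(\<Upsilon>, \<xi>, t, k)" rule: A_coeff.cases) (simp_all add: z_def power_divide)
    also have "(\<Sum>r=1..k-1. A_coeff \<Upsilon> \<xi> t r * B_coeff \<Upsilon> \<xi> r k)
        = (\<Sum>r=1..k-1. \<Sum>m\<le>L'. nilpotent_power \<xi> m r * z ^ Suc m * B_coeff \<Upsilon> \<xi> r k)"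
      using L' False less.IH[of _ L'] by (intro sum.cong) (auto simp: z_def sum_distrib_right)
    also have "\<dots> = (\<Sum>m\<le>L'. z ^ Suc m * (\<Sum>r=1..k-1. nilpotent_power \<xi> m r * B_coeff \<Upsilon> \<xi> r k))"
      by (subst sum.swap) (simp add: sum_distrib_left mult_ac)
    also have "\<xi> k * z\<^sup>2 + z * \<dots> = z * (\<xi> k * z + \<dots>)"
      by (simp add: algebra_simps power2_eq_square)
    also have "\<xi> k * z + (\<Sum>m\<le>L'. z ^ Suc m * (\<Sum>r=1..k-1. nilpotent_power \<xi> m r * B_coeff \<Upsilon> \<xi> r k))
        = (\<Sum>m\<le>L'. z ^ Suc m * (\<xi> k * nilpotent_power \<xi> m 0 + (\<Sum>r=1..k-1. nilpotent_power \<xi> m r * B_coeff \<Upsilon> \<xi> r k)))"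
      by (subst (1) A0[symmetric]) (simp add: distrib_left sum.distrib sum_distrib_left mult_ac)
    also have "\<dots> = (\<Sum>m\<le>L'. z ^ Suc m * nilpotent_power \<xi> (Suc m) k)"
      using False by (simp add: nilpotent_power_Suc nilpotent_part_vmult)
    also have "z * \<dots> = (\<Sum>m\<le>L. nilpotent_power \<xi> m k * z ^ Suc m)"
      using False unfolding L' 
      by (subst sum.atMost_Suc_shift) (simp add: nilpotent_power_0 vone_def sum_distrib_left mult_ac)
    finally show ?thesis by (simp add: z_def)
  qed
qed

lemma line_integral_A_coeff:
  assumes "rectifiable_path \<gamma>" "pos_oriented_jordan_curve \<gamma>" "\<xi> 0 \<in> inside (path_image \<gamma>)"
  shows "line_integral (\<lambda>t. exp t * A_coeff \<Upsilon> \<xi> t k) \<gamma> = 2 * of_real pi * \<i> * vexp \<xi> k"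
proof -
  define z where "z = \<xi> 0"
  obtain H where H: "\<And>m w. w \<noteq> z \<Longrightarrow>
      (H m has_field_derivative exp w / (w - z) ^ Suc m - exp z / fact m / (w - z)) (at w)"
    using exp_pole_primitive[of z] by metis
  have "has_line_integral (\<lambda>t. exp t * A_coeff \<Upsilon> \<xi> t k)
      (2 * of_real pi * \<i> * vexp \<xi> k * winding_number \<gamma> z) \<gamma>"
  proof (rule has_line_integral_residue)
    show "z \<notin> path_image \<gamma>"
      using assms(3) inside_no_overlap unfolding z_def by blast
    fix w assume w: "w \<noteq> z"
    have "((\<lambda>w. \<Sum>m\<le>k. nilpotent_power \<xi> m k * H m w) has_field_derivative
        (\<Sum>m\<le>k. nilpotent_power \<xi> m k * (exp w / (w - z) ^ Suc m - exp z / fact m / (w - z)))) (at w)"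
      by (intro DERIV_sum DERIV_cmult H w)
    also have "(\<Sum>m\<le>k. nilpotent_power \<xi> m k * (exp w / (w - z) ^ Suc m - exp z / fact m / (w - z)))
        = exp w * A_coeff \<Upsilon> \<xi> w k - vexp \<xi> k / (w - z)"
    proof -
      have "nilpotent_power \<xi> m k * (exp w / (w - z) ^ Suc m - exp z / fact m / (w - z))
          = exp w * (nilpotent_power \<xi> m k * (1 / (w - z)) ^ Suc m) - exp z * (nilpotent_power \<xi> m k / fact m) / (w - z)" for m
        by (simp add: right_diff_distrib power_one_over divide_inverse power_inverse mult_ac)
      then show ?thesis
        by (simp only: sum_subtractf sum_distrib_left sum_divide_distrib vexp_def z_def
            A_coeff_eq[OF order_refl])
    qed
    finally show "((\<lambda>w. \<Sum>m\<le>k. nilpotent_power \<xi> m k * H m w) has_field_derivative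
        exp w * A_coeff \<Upsilon> \<xi> w k - vexp \<xi> k / (w - z)) (at w)" .
  qed (use assms in \<open>auto simp: pos_oriented_jordan_curve_def\<close>)
  moreover have "winding_number \<gamma> z = 1"
    using assms(2,3) by (simp add: pos_oriented_jordan_curve_def z_def)
  ultimately show ?thesis by (intro line_integral_eqI) simp
qed

text \<open>
  The power rule along the line \<open>w + h \<eta>\<close>; commutativity of \<open>\<star>\<close> is what brings \<open>m\<close> equal terms together.
\<close>

lemma nilpotent_power_has_vector_derivative:
  "((\<lambda>h. nilpotent_power (\<lambda>i. w i + of_real h * \<eta> i) m k) has_vector_derivative
     of_nat m * (nilpotent_part \<eta> \<star> nilpotent_power w (m - 1)) k) (at 0)"
proof (induction m arbitrary: k)
  case 0
  show ?case by (simp add: nilpotent_power_0)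
next
  case (Suc m)
  have "((\<lambda>h. nilpotent_part (\<lambda>i. w i + of_real h * \<eta> i) i) has_vector_derivative nilpotent_part \<eta> i) (at 0)" for i
    by (cases "i = 0") (auto simp: nilpotent_part_def has_vector_derivative_def intro!: derivative_eq_intros simp: scaleR_conv_of_real)
  from vmult_has_vector_derivative[OF this Suc.IH, where k = k and \<Upsilon> = \<Upsilon>]
  have "((\<lambda>h. nilpotent_power (\<lambda>i. w i + of_real h * \<eta> i) (Suc m) k) has_vector_derivative
      (nilpotent_part w \<star> (\<lambda>i. of_nat m * (nilpotent_part \<eta> \<star> nilpotent_power w (m - 1)) i)) k + (nilpotent_part \<eta> \<star> nilpotent_power w m) k) (at 0)"
    by (simp add: nilpotent_power_Suc)
  moreover have "(nilpotent_part w \<star> (\<lambda>i. of_nat m * (nilpotent_part \<eta> \<star> nilpotent_power w (m - 1)) i)) k = of_nat m * (nilpotent_part \<eta> \<star> nilpotent_power w m) k"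
  proof -
    have "(nilpotent_part w \<star> (\<lambda>i. of_nat m * (nilpotent_part \<eta> \<star> nilpotent_power w (m - 1)) i)) k
        = of_nat m * (nilpotent_part w \<star> (nilpotent_part \<eta> \<star> nilpotent_power w (m - 1))) k"
      by (rule vmult_scale_right)
    also have "\<dots> = of_nat m * (nilpotent_part \<eta> \<star> nilpotent_power w m) k"
      by (cases m) (simp_all add: vmult_left_commute[of "nilpotent_part w"] nilpotent_power_Suc)
    finally show ?thesis .
  qed
  ultimately show ?case by (simp add: distrib_right add.commute)
qed

text \<open>
  The derivative of \<open>exp (w + h \<eta>)\<close> at \<open>h = 0\<close> is \<open>\<eta> \<star> exp w\<close>.  The component \<open>\<eta> 0\<close> comes from the scalar
  factor \<open>e\<^sup>\<xi>\<close>, the rest of \<open>\<eta>\<close> from the series in \<open>N\<close>; the series is cut at \<open>k + 1\<close> so that it still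
  reaches \<open>k\<close> after the shift of index caused by differentiation.
\<close>

lemma vexp_has_vector_derivative:
  "((\<lambda>h. vexp (\<lambda>i. w i + of_real h * \<eta> i) k) has_vector_derivative (\<eta> \<star> vexp w) k) (at 0)"
proof -
  let ?W = "\<lambda>h::real. \<lambda>i. w i + of_real h * \<eta> i"
  define g where "g m = (nilpotent_part \<eta> \<star> nilpotent_power w m) k" for m
  have "((\<lambda>h. w 0 + of_real h * \<eta> 0) has_vector_derivative \<eta> 0) (at 0)"
    by (auto simp: has_vector_derivative_def intro!: derivative_eq_intros simp: scaleR_conv_of_real)
  from field_vector_diff_chain_at[OF this, of exp "exp (w 0)"]
  have "((\<lambda>h. exp (?W h 0)) has_vector_derivative \<eta> 0 * exp (w 0)) (at 0)"
    by (simp add: o_def)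
  moreover have "((\<lambda>h. \<Sum>m\<le>Suc k. nilpotent_power (?W h) m k / fact m) has_vector_derivative
      (\<Sum>m\<le>Suc k. of_nat m * g (m - 1) / fact m)) (at 0)"
    unfolding g_def
    by (intro has_vector_derivative_sum has_vector_derivative_divide nilpotent_power_has_vector_derivative)
  ultimately have "((\<lambda>h. exp (?W h 0) * (\<Sum>m\<le>Suc k. nilpotent_power (?W h) m k / fact m)) has_vector_derivative
      exp (?W 0 0) * (\<Sum>m\<le>Suc k. of_nat m * g (m - 1) / fact m) +
      \<eta> 0 * exp (w 0) * (\<Sum>m\<le>Suc k. nilpotent_power (?W 0) m k / fact m)) (at 0)"
    by (rule has_vector_derivative_mult)
  also have "(\<lambda>h. exp (?W h 0) * (\<Sum>m\<le>Suc k. nilpotent_power (?W h) m k / fact m)) = (\<lambda>h. vexp (?W h) k)"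
    by (rule ext) (subst vexp_eq[of k "Suc k"], simp_all)
  also have "\<eta> 0 * exp (w 0) * (\<Sum>m\<le>Suc k. nilpotent_power (?W 0) m k / fact m) = \<eta> 0 * vexp w k"
    by (subst vexp_eq[of k "Suc k"]) simp_all
  also have "(\<Sum>m\<le>Suc k. of_nat m * g (m - 1) / fact m) = (\<Sum>m\<le>k. g m / fact m)"
    by (subst sum.atMost_Suc_shift) (simp add: field_simps del: of_nat_Suc)
  also have "exp (?W 0 0) * \<dots> = (nilpotent_part \<eta> \<star> vexp w) k"
  proof -
    have "(nilpotent_part \<eta> \<star> vexp w) k = (nilpotent_part \<eta> \<star> (\<lambda>i. exp (w 0) * (\<Sum>m\<le>k. (1 / fact m) * nilpotent_power w m i))) k"
      by (rule vmult_cong) (auto simp: vexp_eq)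
    also have "\<dots> = exp (w 0) * (\<Sum>m\<le>k. (1 / fact m) * (nilpotent_power w m \<star> nilpotent_part \<eta>) k)"
      by (simp only: vmult_scale_left vmult_commute[of "nilpotent_part \<eta>"] vmult_sum_left)
    also have "\<dots> = exp (?W 0 0) * (\<Sum>m\<le>k. g m / fact m)"
      by (simp add: g_def vmult_commute[of "nilpotent_part \<eta>"])
    finally show ?thesis by simp
  qed
  also have "(nilpotent_part \<eta> \<star> vexp w) k + \<eta> 0 * vexp w k = (\<eta> \<star> vexp w) k"
  proof -
    have "\<eta> = (\<lambda>i. nilpotent_part \<eta> i + \<eta> 0 * vone i)"
      by (auto simp: nilpotent_part_def vone_def)
    then have "(\<eta> \<star> vexp w) k = ((\<lambda>i. nilpotent_part \<eta> i + \<eta> 0 * vone i) \<star> vexp w) k" by simp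
    then show ?thesis by (simp add: vmult_add_left vmult_scale_left vmult_vone)
  qed
  finally show ?thesis .
qed

end


section \<open>The exponential solves the differential equation\<close>

context extensions
begin

lemma continuous_vmult:
  assumes "\<And>i. i \<le> k \<Longrightarrow> continuous_on S (\<lambda>x. F x i)" "\<And>i. i \<le> k \<Longrightarrow> continuous_on S (\<lambda>x. G x i)"
  shows "continuous_on S (\<lambda>x. (F x \<star> G x) k)"
  unfolding vmult_def by (intro continuous_intros assms) auto

lemma continuous_vexp:
  fixes a :: "'d::finite \<Rightarrow> nat \<Rightarrow> complex"
  shows "continuous_on UNIV (\<lambda>x. vexp (xi a x) k)"
proof -
  have xi: "continuous_on UNIV (\<lambda>x. xi a x i)" for i
    unfolding xi_def by (intro continuous_intros)
  have "continuous_on UNIV (\<lambda>x. nilpotent_part (xi a x) i)" for i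
    by (cases "i = 0") (simp_all add: nilpotent_part_def xi)
  then have "continuous_on UNIV (\<lambda>x. nilpotent_power (xi a x) m i)" for m i
    by (induction m arbitrary: i) (simp_all add: nilpotent_power_0 nilpotent_power_Suc continuous_vmult)
  then show ?thesis
    unfolding vexp_def by (intro continuous_intros xi) auto
qed

lemma xi_axis: "xi a (x + h *\<^sub>R axis j 1) = (\<lambda>i. xi a x i + of_real h * a j i)"
proof
  fix i
  have "xi a (x + h *\<^sub>R axis j 1) i = xi a x i + (\<Sum>l\<in>UNIV. if l = j then of_real h * a l i else 0)"
    unfolding xi_def sum.distrib[symmetric]
    by (intro sum.cong) (auto simp: axis_def distrib_right)
  then show "xi a (x + h *\<^sub>R axis j 1) i = xi a x i + of_real h * a j i" by simp
qed

text \<open>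
  The functions \<open>x \<mapsto> (c \<star> exp \<zeta>(x))\<^sub>k\<close>, for arbitrary formal vectors \<open>c\<close>, are closed under partial
  differentiation; this family is the induction invariant for iterated derivatives.
\<close>

lemma vmult_vexp_has_partial_deriv:
  "((\<lambda>h. (c \<star> vexp (xi a (x + h *\<^sub>R axis j 1))) k) has_vector_derivative
     (a j \<star> c \<star> vexp (xi a x)) k) (at 0)"
proof -
  have "((\<lambda>h. (c \<star> vexp (xi a (x + h *\<^sub>R axis j 1))) k) has_vector_derivative
      (c \<star> (a j \<star> vexp (xi a x))) k + ((\<lambda>i. 0) \<star> vexp (xi a (x + 0 *\<^sub>R axis j 1))) k) (at 0)"
    unfolding xi_axis[of a x]
    by (rule vmult_has_vector_derivative[where F = "\<lambda>h. c"])
       (auto intro!: vexp_has_vector_derivative)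
  moreover have "((\<lambda>i. 0) \<star> v) k = 0" for v by (simp add: vmult_def)
  ultimately show ?thesis by (simp add: vmult_assoc vmult_left_commute[of c])
qed

lemma partial_deriv_vmult_vexp:
  "partial_deriv j (\<lambda>x. (c \<star> vexp (xi a x)) k) = (\<lambda>x. (a j \<star> c \<star> vexp (xi a x)) k)"
  unfolding partial_deriv_def
  by (intro ext vector_derivative_at vmult_vexp_has_partial_deriv)

lemma C_class_vmult_vexp: "C_class p (\<lambda>x. (c \<star> vexp (xi a x)) k)"
proof (induction p arbitrary: c)
  case 0
  then show ?case by (simp add: continuous_vmult continuous_vexp)
next
  case (Suc p)
  have "(\<lambda>h. (c \<star> vexp (xi a (x + h *\<^sub>R axis j 1))) k) differentiable (at 0)" for x j
    using vmult_vexp_has_partial_deriv by (rule differentiableI_vector)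
  then show ?case
    by (simp add: continuous_vmult continuous_vexp partial_deriv_vmult_vexp Suc.IH)
qed

lemma mixed_partial_vexp:
  "mixed_partial \<alpha> (\<lambda>x. vexp (xi a x) k) x = (monomial a \<alpha> \<star> vexp (xi a x)) k"
proof -
  have pow: "(partial_deriv j ^^ m) (\<lambda>x. (c \<star> vexp (xi a x)) k)
      = (\<lambda>x. ((((\<star>) (a j)) ^^ m) c \<star> vexp (xi a x)) k)" for j m c
    by (induction m) (simp_all add: partial_deriv_vmult_vexp)
  have "foldr (\<lambda>j. partial_deriv j ^^ \<alpha> j) js (\<lambda>x. (vone \<star> vexp (xi a x)) k)
      = (\<lambda>x. (foldr (\<lambda>j. ((\<star>) (a j)) ^^ \<alpha> j) js vone \<star> vexp (xi a x)) k)" for js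
    by (induction js) (simp_all add: pow)
  then show ?thesis
    by (simp add: mixed_partial_def monomial_def vmult_vone)
qed

lemma solves_pde_vexp:
  fixes a :: "'d::{finite,linorder} \<Rightarrow> nat \<Rightarrow> complex"
  assumes "\<And>n. n \<ge> 2 \<Longrightarrow> characteristic_value (\<E> n) p C (\<lambda>j. truncation (\<E> n) (I n) n (a j)) = \<zero>\<^bsub>\<E> n\<^esub>"
  shows "solves_pde p C (\<lambda>x. vexp (xi a x) k)"
  unfolding solves_pde_def
proof (intro conjI allI)
  show "C_class p (\<lambda>x. vexp (xi a x) k)"
    using C_class_vmult_vexp[of p vone] by (simp add: vmult_vone)
  fix x
  have "diff_operator p C (\<lambda>x. vexp (xi a x) k) x
      = ((\<lambda>i. \<Sum>l\<le>p. 1 * (\<Sum>\<alpha>\<in>multi_indices l. complex_of_real (C l \<alpha>) * monomial a \<alpha> i)) \<star> vexp (xi a x)) k"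
    unfolding vmult_sum_left by (simp add: diff_operator_def mixed_partial_vexp)
  then show "diff_operator p C (\<lambda>x. vexp (xi a x) k) x = 0"
    by (simp add: characteristic_equation[OF assms] vmult_def)
qed

end


theorem mainTheorem4:
  fixes p :: nat
    and C :: "nat \<Rightarrow> ('d::{finite,linorder} \<Rightarrow> nat) \<Rightarrow> real"
    and \<E> :: "nat \<Rightarrow> (complex, 'a) module"
    and I :: "nat \<Rightarrow> nat \<Rightarrow> 'a"
    and \<Upsilon> :: "nat \<Rightarrow> nat \<Rightarrow> nat \<Rightarrow> complex"
    and a :: "'d \<Rightarrow> nat \<Rightarrow> complex"
    and \<Gamma> :: "(real, 'd) vec \<Rightarrow> real \<Rightarrow> complex"
    and k :: nat
  assumes "CARD('d) \<ge> 2" and "p \<ge> 1"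
    and "extension_sequence \<E> I \<Upsilon>"
    and "\<forall>n\<ge>2. characteristic_value (\<E> n) p C (\<lambda>j. truncation (\<E> n) (I n) n (a j)) = \<zero>\<^bsub>\<E> n\<^esub>"
    and "\<forall>x. pos_oriented_jordan_curve (\<Gamma> x) \<and> rectifiable_path (\<Gamma> x) \<and>
           xi a x 0 \<in> inside (path_image (\<Gamma> x))"
  shows "solves_pde p C (u_fun \<Upsilon> a \<Gamma> k)"
proof -
  interpret extensions \<E> I \<Upsilon> by unfold_locales fact
  have "u_fun \<Upsilon> a \<Gamma> k = (\<lambda>x. vexp (xi a x) k)"
    using assms(5) by (intro ext) (simp add: u_fun_def line_integral_A_coeff)
  moreover have "solves_pde p C (\<lambda>x. vexp (xi a x) k)"
    by (rule solves_pde_vexp) (use assms(4) in blast)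
  ultimately show ?thesis by simp
qed

end
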